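(* Let $R$ be a ring. Then $UM_{\mathbb N}(R)$ is directly (respectively, stably) finite if and only if $R$ is directly (respectively, stably) finite.
   Context: Rings are associative and unital (not necessarily commutative). $\mathbb N=\{0,1,2,\dots\}$. $UM_{\mathbb N}(R)$ is the ring of upper triangular $\mathbb N\times\mathbb N$ matrices over $R$, i.e. all matrices $M$ with entries $M(i,j)\in R$ ($i,j\in\mathbb N$) such that $M(i,j)=0$ if $i>j$, with the usual matrix addition and multiplication. A ring $R$ is directly finite if, for any $r,s\in R$, $rs=1$ implies $sr=1$. A ring $R$ is stably finite if the ring $M_n(R)$ of $n\times n$ matrices over $R$ is directly finite for every positive integer $n$. *)

theory Defs
  imports "HOL-Algebra.Ring"
begin

definition directly_finite :: "('a, 'm) ring_scheme \<Rightarrow> bool" where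
  "directly_finite R \<longleftrightarrow>
     (\<forall>r\<in>carrier R. \<forall>s\<in>carrier R. r \<otimes>\<^bsub>R\<^esub> s = \<one>\<^bsub>R\<^esub> \<longrightarrow> s \<otimes>\<^bsub>R\<^esub> r = \<one>\<^bsub>R\<^esub>)"

text \<open>Matrices of size \<open>n \<times> n\<close> are indexed from \<open>0\<close> to \<open>n - 1\<close>. They are extensional functions,
  so that equality of matrices is equality of the entries inside the index range.\<close>

definition mat_ring :: "nat \<Rightarrow> ('a, 'm) ring_scheme \<Rightarrow> (nat \<Rightarrow> nat \<Rightarrow> 'a) ring" where
  "mat_ring n R =
     \<lparr>carrier = {..<n} \<rightarrow>\<^sub>E ({..<n} \<rightarrow>\<^sub>E carrier R),
      mult = (\<lambda>M N. \<lambda>i\<in>{..<n}. \<lambda>j\<in>{..<n}. \<Oplus>\<^bsub>R\<^esub>k\<in>{..<n}. M i k \<otimes>\<^bsub>R\<^esub> N k j),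
      one = (\<lambda>i\<in>{..<n}. \<lambda>j\<in>{..<n}. if i = j then \<one>\<^bsub>R\<^esub> else \<zero>\<^bsub>R\<^esub>),
      zero = (\<lambda>i\<in>{..<n}. \<lambda>j\<in>{..<n}. \<zero>\<^bsub>R\<^esub>),
      add = (\<lambda>M N. \<lambda>i\<in>{..<n}. \<lambda>j\<in>{..<n}. M i j \<oplus>\<^bsub>R\<^esub> N i j)\<rparr>"

definition stably_finite :: "('a, 'm) ring_scheme \<Rightarrow> bool" where
  "stably_finite R \<longleftrightarrow> (\<forall>n>0. directly_finite (mat_ring n R))"

text \<open>For upper triangular \<open>M\<close> and \<open>N\<close>, the product \<open>M i k \<otimes> N k j\<close> vanishes unless
  \<open>i \<le> k \<le> j\<close>, so the usual row-by-column sum over all natural numbers \<open>k\<close> is the finite sum below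
  (which is empty, hence zero, for \<open>i > j\<close>).\<close>

definition UM_nat :: "('a, 'm) ring_scheme \<Rightarrow> (nat \<Rightarrow> nat \<Rightarrow> 'a) ring" where
  "UM_nat R =
     \<lparr>carrier = {M. (\<forall>i j. M i j \<in> carrier R) \<and> (\<forall>i j. i > j \<longrightarrow> M i j = \<zero>\<^bsub>R\<^esub>)},
      mult = (\<lambda>M N i j. \<Oplus>\<^bsub>R\<^esub>k\<in>{i..j}. M i k \<otimes>\<^bsub>R\<^esub> N k j),
      one = (\<lambda>i j. if i = j then \<one>\<^bsub>R\<^esub> else \<zero>\<^bsub>R\<^esub>),
      zero = (\<lambda>i j. \<zero>\<^bsub>R\<^esub>),
      add = (\<lambda>M N i j. M i j \<oplus>\<^bsub>R\<^esub> N i j)\<rparr>"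

end

theory Submission
  imports Defs
begin

text \<open>If \<open>M N = 1\<close> for upper triangular \<open>M\<close> and \<open>N\<close> over a directly finite ring, then the
  diagonal entries are mutually inverse, so the idempotent \<open>E = N M\<close> has ones on its diagonal.
  Comparing the entries of \<open>E E = E\<close> diagonal by diagonal gives \<open>E = 1\<close>. The converse holds
  because \<open>R\<close> embeds as scalar matrices. Stable finiteness reduces to direct finiteness through the
  identification of \<open>n \<times> n\<close> matrices over \<open>UM_nat R\<close> with upper triangular matrices over the ring of
  \<open>n \<times> n\<close> matrices.\<close>

section \<open>Finite sums\<close>

context abelian_monoid
begin

text \<open>This evaluates products with an identity matrix, where one index survives in each
  row-by-column sum.\<close>

lemma finsum_unique_nonzero:
  assumes "finite A" "i \<in> A" "f i \<in> carrier G" "\<And>k. \<lbrakk>k \<in> A; k \<noteq> i\<rbrakk> \<Longrightarrow> f k = \<zero>"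
  shows "(\<Oplus>k\<in>A. f k) = f i"
proof -
  have "f k \<in> carrier G" if "k \<in> A" for k
    using assms that by (cases "k = i") auto
  then have "(\<Oplus>k\<in>A. f k) = (\<Oplus>k\<in>{i}. f k)"
    by (intro add.finprod_mono_neutral_cong_right) (use assms in auto)
  then show ?thesis using assms by simp
qed

lemma finsum_eq_zero:
  "(\<And>k. k \<in> A \<Longrightarrow> f k = \<zero>) \<Longrightarrow> (\<Oplus>k\<in>A. f k) = \<zero>"
  by (rule add.finprod_one_eqI)

text \<open>Induction on \<open>A\<close>: the row of the new index \<open>x\<close> is split off
  and merged into the inner sums by additivity. It serves associativity of matrix multiplication
  and, later, the exchange of the two matrix constructions.\<close>

lemma finsum_swap:
  assumes "finite A" "finite B" "\<And>i j. \<lbrakk>i \<in> A; j \<in> B\<rbrakk> \<Longrightarrow> f i j \<in> carrier G"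
  shows "(\<Oplus>i\<in>A. \<Oplus>j\<in>B. f i j) = (\<Oplus>j\<in>B. \<Oplus>i\<in>A. f i j)"
  using assms(1,3)
proof (induction A rule: finite_induct)
  case empty
  then show ?case by simp
next
  case (insert x A)
  have "(\<Oplus>i\<in>insert x A. \<Oplus>j\<in>B. f i j) = (\<Oplus>j\<in>B. f x j) \<oplus> (\<Oplus>j\<in>B. \<Oplus>i\<in>A. f i j)"
    using insert by (subst finsum_insert) (auto intro!: finsum_closed)
  also have "\<dots> = (\<Oplus>j\<in>B. f x j \<oplus> (\<Oplus>i\<in>A. f i j))"
    using insert by (subst finsum_addf) (auto intro!: finsum_closed)
  also have "\<dots> = (\<Oplus>j\<in>B. \<Oplus>i\<in>insert x A. f i j)"
    using insert by (intro add.finprod_cong') (auto intro!: finsum_closed)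
  finally show ?case .
qed

end

text \<open>The common core of associativity for both kinds of matrices: multiply out, reassociate
  each term, swap the sums and factor again. The inner index set is independent of the outer index,
  which upper triangular products satisfy only after a change of range.\<close>

lemma (in ring) finsum_mult_assoc:
  assumes "finite A" "finite B"
    and "\<And>l. l \<in> A \<Longrightarrow> f l \<in> carrier R"
    and "\<And>l k. \<lbrakk>l \<in> A; k \<in> B\<rbrakk> \<Longrightarrow> g l k \<in> carrier R"
    and "\<And>k. k \<in> B \<Longrightarrow> h k \<in> carrier R"
  shows "(\<Oplus>k\<in>B. (\<Oplus>l\<in>A. f l \<otimes> g l k) \<otimes> h k) = (\<Oplus>l\<in>A. f l \<otimes> (\<Oplus>k\<in>B. g l k \<otimes> h k))"
proof -
  have "(\<Oplus>k\<in>B. (\<Oplus>l\<in>A. f l \<otimes> g l k) \<otimes> h k) = (\<Oplus>k\<in>B. \<Oplus>l\<in>A. f l \<otimes> (g l k \<otimes> h k))"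
    using assms
    by (intro add.finprod_cong')
      (auto simp: finsum_ldistr Pi_def m_assoc intro!: finsum_closed add.finprod_cong')
  also have "\<dots> = (\<Oplus>l\<in>A. \<Oplus>k\<in>B. f l \<otimes> (g l k \<otimes> h k))"
    using assms by (intro finsum_swap) auto
  also have "\<dots> = (\<Oplus>l\<in>A. f l \<otimes> (\<Oplus>k\<in>B. g l k \<otimes> h k))"
    using assms
    by (intro add.finprod_cong')
      (auto simp: finsum_rdistr Pi_def intro!: finsum_closed)
  finally show ?thesis .
qed

section \<open>Matrix rings\<close>

lemma mat_ring_entry_closed:
  "\<lbrakk>M \<in> carrier (mat_ring n R); i < n; j < n\<rbrakk> \<Longrightarrow> M i j \<in> carrier R"
  by (auto simp: mat_ring_def PiE_iff)

lemma mat_ring_closedI: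
  "(\<And>i j. \<lbrakk>i < n; j < n\<rbrakk> \<Longrightarrow> f i j \<in> carrier R) \<Longrightarrow>
    (\<lambda>i\<in>{..<n}. \<lambda>j\<in>{..<n}. f i j) \<in> carrier (mat_ring n R)"
  by (auto simp: mat_ring_def)

text \<open>Extensionality at both levels of the function space fixes all values outside the index
  range, so entries inside it determine the matrix.\<close>

lemma mat_ring_eqI:
  assumes "M \<in> carrier (mat_ring n R)" "N \<in> carrier (mat_ring n R)"
    and "\<And>i j. \<lbrakk>i < n; j < n\<rbrakk> \<Longrightarrow> M i j = N i j"
  shows "M = N"
proof (rule PiE_ext)
  show M: "M \<in> {..<n} \<rightarrow>\<^sub>E ({..<n} \<rightarrow>\<^sub>E carrier R)" and N: "N \<in> {..<n} \<rightarrow>\<^sub>E ({..<n} \<rightarrow>\<^sub>E carrier R)"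
    using assms by (auto simp: mat_ring_def)
  fix i assume i: "i \<in> {..<n}"
  show "M i = N i"
    by (rule PiE_ext[OF PiE_mem[OF M i] PiE_mem[OF N i]]) (use assms i in auto)
qed

lemma mat_ring_entries:
  assumes "i < n" "j < n"
  shows "(M \<otimes>\<^bsub>mat_ring n R\<^esub> N) i j = (\<Oplus>\<^bsub>R\<^esub>k\<in>{..<n}. M i k \<otimes>\<^bsub>R\<^esub> N k j)"
    and "\<one>\<^bsub>mat_ring n R\<^esub> i j = (if i = j then \<one>\<^bsub>R\<^esub> else \<zero>\<^bsub>R\<^esub>)"
    and "\<zero>\<^bsub>mat_ring n R\<^esub> i j = \<zero>\<^bsub>R\<^esub>"
    and "(M \<oplus>\<^bsub>mat_ring n R\<^esub> N) i j = M i j \<oplus>\<^bsub>R\<^esub> N i j"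
  using assms by (simp_all add: mat_ring_def)

context ring
begin

lemma mat_ring_closed:
  shows "\<one>\<^bsub>mat_ring n R\<^esub> \<in> carrier (mat_ring n R)"
    and "\<zero>\<^bsub>mat_ring n R\<^esub> \<in> carrier (mat_ring n R)"
    and "\<lbrakk>M \<in> carrier (mat_ring n R); N \<in> carrier (mat_ring n R)\<rbrakk> \<Longrightarrow>
      M \<otimes>\<^bsub>mat_ring n R\<^esub> N \<in> carrier (mat_ring n R)"
    and "\<lbrakk>M \<in> carrier (mat_ring n R); N \<in> carrier (mat_ring n R)\<rbrakk> \<Longrightarrow>
      M \<oplus>\<^bsub>mat_ring n R\<^esub> N \<in> carrier (mat_ring n R)"
  by (auto simp: mat_ring_def PiE_iff intro!: finsum_closed)

text \<open>Each identity is checked entry by entry through \<open>mat_ring_eqI\<close>. The case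
  \<open>n = 0\<close> is included and gives the zero ring.\<close>

lemma ring_mat_ring: "ring (mat_ring n R)"
proof (rule ringI)
  show "abelian_group (mat_ring n R)"
  proof (rule abelian_groupI)
    fix M assume M: "M \<in> carrier (mat_ring n R)"
    let ?N = "\<lambda>i\<in>{..<n}. \<lambda>j\<in>{..<n}. \<ominus> M i j"
    have N: "?N \<in> carrier (mat_ring n R)"
      using M by (intro mat_ring_closedI) (auto dest: mat_ring_entry_closed)
    show "\<exists>N\<in>carrier (mat_ring n R). N \<oplus>\<^bsub>mat_ring n R\<^esub> M = \<zero>\<^bsub>mat_ring n R\<^esub>"
      using M N
      by (intro bexI[of _ ?N] mat_ring_eqI[of _ n R] mat_ring_closed)
        (auto simp: mat_ring_entries mat_ring_entry_closed l_neg)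
  qed (auto intro!: mat_ring_closed mat_ring_eqI[of _ n R]
      simp: mat_ring_entries mat_ring_entry_closed a_ac)
  show "monoid (mat_ring n R)"
  proof
    fix L M N
    assume LMN: "L \<in> carrier (mat_ring n R)" "M \<in> carrier (mat_ring n R)"
      "N \<in> carrier (mat_ring n R)"
    show "L \<otimes>\<^bsub>mat_ring n R\<^esub> M \<otimes>\<^bsub>mat_ring n R\<^esub> N = L \<otimes>\<^bsub>mat_ring n R\<^esub> (M \<otimes>\<^bsub>mat_ring n R\<^esub> N)"
    proof (intro mat_ring_eqI[of _ n R] mat_ring_closed LMN)
      fix i j assume ij: "i < n" "j < n"
      have "(L \<otimes>\<^bsub>mat_ring n R\<^esub> M \<otimes>\<^bsub>mat_ring n R\<^esub> N) i j =
          (\<Oplus>k\<in>{..<n}. (\<Oplus>l\<in>{..<n}. L i l \<otimes> M l k) \<otimes> N k j)"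
        using ij LMN unfolding mat_ring_entries(1)[OF ij]
        by (intro add.finprod_cong')
          (auto simp: mat_ring_entries mat_ring_entry_closed intro!: finsum_closed)
      also have "\<dots> = (\<Oplus>l\<in>{..<n}. L i l \<otimes> (\<Oplus>k\<in>{..<n}. M l k \<otimes> N k j))"
        using ij LMN by (intro finsum_mult_assoc) (auto simp: mat_ring_entry_closed)
      also have "\<dots> = (L \<otimes>\<^bsub>mat_ring n R\<^esub> (M \<otimes>\<^bsub>mat_ring n R\<^esub> N)) i j"
        using ij LMN unfolding mat_ring_entries(1)[OF ij]
        by (intro add.finprod_cong')
          (auto simp: mat_ring_entries mat_ring_entry_closed intro!: finsum_closed)
      finally show "(L \<otimes>\<^bsub>mat_ring n R\<^esub> M \<otimes>\<^bsub>mat_ring n R\<^esub> N) i j =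
        (L \<otimes>\<^bsub>mat_ring n R\<^esub> (M \<otimes>\<^bsub>mat_ring n R\<^esub> N)) i j" .
    qed
  next
    fix M assume M: "M \<in> carrier (mat_ring n R)"
    show "\<one>\<^bsub>mat_ring n R\<^esub> \<otimes>\<^bsub>mat_ring n R\<^esub> M = M"
    proof (intro mat_ring_eqI[of _ n R] mat_ring_closed M)
      fix i j assume ij: "i < n" "j < n"
      show "(\<one>\<^bsub>mat_ring n R\<^esub> \<otimes>\<^bsub>mat_ring n R\<^esub> M) i j = M i j"
        unfolding mat_ring_entries(1)[OF ij]
        by (subst finsum_unique_nonzero[of _ i])
          (use ij M in \<open>auto simp: mat_ring_entries mat_ring_entry_closed\<close>)
    qed
    show "M \<otimes>\<^bsub>mat_ring n R\<^esub> \<one>\<^bsub>mat_ring n R\<^esub> = M"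
    proof (intro mat_ring_eqI[of _ n R] mat_ring_closed M)
      fix i j assume ij: "i < n" "j < n"
      show "(M \<otimes>\<^bsub>mat_ring n R\<^esub> \<one>\<^bsub>mat_ring n R\<^esub>) i j = M i j"
        unfolding mat_ring_entries(1)[OF ij]
        by (subst finsum_unique_nonzero[of _ j])
          (use ij M in \<open>auto simp: mat_ring_entries mat_ring_entry_closed\<close>)
    qed
  qed (auto intro: mat_ring_closed)
next
  fix L M N
  assume LMN: "L \<in> carrier (mat_ring n R)" "M \<in> carrier (mat_ring n R)"
    "N \<in> carrier (mat_ring n R)"
  show "(L \<oplus>\<^bsub>mat_ring n R\<^esub> M) \<otimes>\<^bsub>mat_ring n R\<^esub> N =
      L \<otimes>\<^bsub>mat_ring n R\<^esub> N \<oplus>\<^bsub>mat_ring n R\<^esub> M \<otimes>\<^bsub>mat_ring n R\<^esub> N"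
  proof (intro mat_ring_eqI[of _ n R] mat_ring_closed LMN)
    fix i j assume ij: "i < n" "j < n"
    show "((L \<oplus>\<^bsub>mat_ring n R\<^esub> M) \<otimes>\<^bsub>mat_ring n R\<^esub> N) i j =
        (L \<otimes>\<^bsub>mat_ring n R\<^esub> N \<oplus>\<^bsub>mat_ring n R\<^esub> M \<otimes>\<^bsub>mat_ring n R\<^esub> N) i j"
    proof -
      have "((L \<oplus>\<^bsub>mat_ring n R\<^esub> M) \<otimes>\<^bsub>mat_ring n R\<^esub> N) i j = (\<Oplus>k\<in>{..<n}. L i k \<otimes> N k j \<oplus> M i k \<otimes> N k j)"
        unfolding mat_ring_entries(1)[OF ij] using ij LMN
        by (intro add.finprod_cong')
          (auto simp: mat_ring_entries mat_ring_entry_closed l_distr)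
      then show ?thesis
        using ij LMN by (simp add: mat_ring_entries mat_ring_entry_closed Pi_def)
    qed
  qed
  show "N \<otimes>\<^bsub>mat_ring n R\<^esub> (L \<oplus>\<^bsub>mat_ring n R\<^esub> M) =
      N \<otimes>\<^bsub>mat_ring n R\<^esub> L \<oplus>\<^bsub>mat_ring n R\<^esub> N \<otimes>\<^bsub>mat_ring n R\<^esub> M"
  proof (intro mat_ring_eqI[of _ n R] mat_ring_closed LMN)
    fix i j assume ij: "i < n" "j < n"
    show "(N \<otimes>\<^bsub>mat_ring n R\<^esub> (L \<oplus>\<^bsub>mat_ring n R\<^esub> M)) i j =
        (N \<otimes>\<^bsub>mat_ring n R\<^esub> L \<oplus>\<^bsub>mat_ring n R\<^esub> N \<otimes>\<^bsub>mat_ring n R\<^esub> M) i j"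
    proof -
      have "(N \<otimes>\<^bsub>mat_ring n R\<^esub> (L \<oplus>\<^bsub>mat_ring n R\<^esub> M)) i j = (\<Oplus>k\<in>{..<n}. N i k \<otimes> L k j \<oplus> N i k \<otimes> M k j)"
        unfolding mat_ring_entries(1)[OF ij] using ij LMN
        by (intro add.finprod_cong')
          (auto simp: mat_ring_entries mat_ring_entry_closed r_distr)
      then show ?thesis
        using ij LMN by (simp add: mat_ring_entries mat_ring_entry_closed Pi_def)
    qed
  qed
qed

text \<open>Taking a fixed entry is additive, so it passes through finite sums. It is applied to
  products in \<open>UM_nat (mat_ring n R)\<close>, whose entries are sums of matrices.\<close>

lemma mat_ring_finsum_entry:
  assumes "finite A" "\<And>k. k \<in> A \<Longrightarrow> f k \<in> carrier (mat_ring n R)" "i < n" "j < n"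
  shows "(\<Oplus>\<^bsub>mat_ring n R\<^esub>k\<in>A. f k) i j = (\<Oplus>k\<in>A. f k i j)"
  using assms(1,2)
proof (induction A rule: finite_induct)
  case empty
  interpret MR: ring "mat_ring n R" by (rule ring_mat_ring)
  show ?case using assms by (simp add: mat_ring_entries)
next
  case (insert x A)
  interpret MR: ring "mat_ring n R" by (rule ring_mat_ring)
  have "(\<Oplus>\<^bsub>mat_ring n R\<^esub>k\<in>insert x A. f k) = f x \<oplus>\<^bsub>mat_ring n R\<^esub> (\<Oplus>\<^bsub>mat_ring n R\<^esub>k\<in>A. f k)"
    using insert by (intro MR.finsum_insert) auto
  moreover have "(\<Oplus>k\<in>insert x A. f k i j) = f x i j \<oplus> (\<Oplus>k\<in>A. f k i j)"
    using insert assms by (intro finsum_insert) (auto intro: mat_ring_entry_closed)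
  ultimately show ?case
    using insert assms by (simp add: mat_ring_entries)
qed

end

section \<open>Upper triangular matrices\<close>

lemma UM_nat_entry_closed: "M \<in> carrier (UM_nat R) \<Longrightarrow> M i j \<in> carrier R"
  by (simp add: UM_nat_def)

lemma UM_nat_entry_zero: "M \<in> carrier (UM_nat R) \<Longrightarrow> j < i \<Longrightarrow> M i j = \<zero>\<^bsub>R\<^esub>"
  by (simp add: UM_nat_def)

lemma UM_nat_entries:
  shows "(M \<otimes>\<^bsub>UM_nat R\<^esub> N) i j = (\<Oplus>\<^bsub>R\<^esub>k\<in>{i..j}. M i k \<otimes>\<^bsub>R\<^esub> N k j)"
    and "\<one>\<^bsub>UM_nat R\<^esub> i j = (if i = j then \<one>\<^bsub>R\<^esub> else \<zero>\<^bsub>R\<^esub>)"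
    and "\<zero>\<^bsub>UM_nat R\<^esub> i j = \<zero>\<^bsub>R\<^esub>"
    and "(M \<oplus>\<^bsub>UM_nat R\<^esub> N) i j = M i j \<oplus>\<^bsub>R\<^esub> N i j"
  by (simp_all add: UM_nat_def)

context ring
begin

lemma UM_nat_closed:
  shows "\<one>\<^bsub>UM_nat R\<^esub> \<in> carrier (UM_nat R)"
    and "\<zero>\<^bsub>UM_nat R\<^esub> \<in> carrier (UM_nat R)"
    and "\<lbrakk>M \<in> carrier (UM_nat R); N \<in> carrier (UM_nat R)\<rbrakk> \<Longrightarrow>
      M \<otimes>\<^bsub>UM_nat R\<^esub> N \<in> carrier (UM_nat R)"
    and "\<lbrakk>M \<in> carrier (UM_nat R); N \<in> carrier (UM_nat R)\<rbrakk> \<Longrightarrow>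
      M \<oplus>\<^bsub>UM_nat R\<^esub> N \<in> carrier (UM_nat R)"
  by (auto simp: UM_nat_def intro!: finsum_closed)

lemma ring_UM_nat: "ring (UM_nat R)"
proof (rule ringI)
  show "abelian_group (UM_nat R)"
  proof (rule abelian_groupI)
    fix M assume M: "M \<in> carrier (UM_nat R)"
    then show "\<exists>N\<in>carrier (UM_nat R). N \<oplus>\<^bsub>UM_nat R\<^esub> M = \<zero>\<^bsub>UM_nat R\<^esub>"
      by (intro bexI[of _ "\<lambda>i j. \<ominus> M i j"] ext) (auto simp: UM_nat_def l_neg)
  qed (auto intro!: UM_nat_closed
      simp: fun_eq_iff UM_nat_entries UM_nat_entry_closed a_ac)
  show "monoid (UM_nat R)"
  proof
    fix L M N
    assume LMN: "L \<in> carrier (UM_nat R)" "M \<in> carrier (UM_nat R)" "N \<in> carrier (UM_nat R)"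
    note closed = LMN[THEN UM_nat_entry_closed] and zero = LMN[THEN UM_nat_entry_zero]
    show "L \<otimes>\<^bsub>UM_nat R\<^esub> M \<otimes>\<^bsub>UM_nat R\<^esub> N = L \<otimes>\<^bsub>UM_nat R\<^esub> (M \<otimes>\<^bsub>UM_nat R\<^esub> N)"
    proof (intro ext)
      fix i j
      \<comment> \<open>In the product the inner range \<open>{i..k}\<close> moves with the outer
        index \<open>k\<close>. Extending it to \<open>{i..j}\<close> adds only terms with
        \<open>l > k\<close>, where \<open>M l k\<close> lies below the diagonal; after this both
        double sums run over the same square.\<close>
      have LM: "(\<Oplus>l\<in>{i..k}. L i l \<otimes> M l k) = (\<Oplus>l\<in>{i..j}. L i l \<otimes> M l k)" if "k \<le> j" for k
        by (rule add.finprod_mono_neutral_cong_left) (use that in \<open>auto simp: closed zero\<close>)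
      \<comment> \<open>Likewise the added terms have \<open>k < l\<close>, so \<open>M l k\<close>
        vanishes again.\<close>
      have MN: "(\<Oplus>k\<in>{l..j}. M l k \<otimes> N k j) = (\<Oplus>k\<in>{i..j}. M l k \<otimes> N k j)" if "i \<le> l" for l
        by (rule add.finprod_mono_neutral_cong_left) (use that in \<open>auto simp: closed zero\<close>)
      have "(L \<otimes>\<^bsub>UM_nat R\<^esub> M \<otimes>\<^bsub>UM_nat R\<^esub> N) i j =
          (\<Oplus>k\<in>{i..j}. (\<Oplus>l\<in>{i..j}. L i l \<otimes> M l k) \<otimes> N k j)"
        unfolding UM_nat_entries
        by (intro add.finprod_cong') (auto simp: LM closed intro!: finsum_closed)
      also have "\<dots> = (\<Oplus>l\<in>{i..j}. L i l \<otimes> (\<Oplus>k\<in>{i..j}. M l k \<otimes> N k j))"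
        by (intro finsum_mult_assoc) (auto simp: closed)
      also have "\<dots> = (L \<otimes>\<^bsub>UM_nat R\<^esub> (M \<otimes>\<^bsub>UM_nat R\<^esub> N)) i j"
        unfolding UM_nat_entries
        by (intro add.finprod_cong') (auto simp: MN closed intro!: finsum_closed)
      finally show "(L \<otimes>\<^bsub>UM_nat R\<^esub> M \<otimes>\<^bsub>UM_nat R\<^esub> N) i j =
        (L \<otimes>\<^bsub>UM_nat R\<^esub> (M \<otimes>\<^bsub>UM_nat R\<^esub> N)) i j" .
    qed
  next
    fix M assume M: "M \<in> carrier (UM_nat R)"
    show "\<one>\<^bsub>UM_nat R\<^esub> \<otimes>\<^bsub>UM_nat R\<^esub> M = M"
    proof (intro ext)
      fix i j
      show "(\<one>\<^bsub>UM_nat R\<^esub> \<otimes>\<^bsub>UM_nat R\<^esub> M) i j = M i j"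
      \<comment> \<open>Only for \<open>i \<le> j\<close> does the range contain the surviving
        index; otherwise the sum is empty and \<open>M i j\<close> is zero as well.\<close>
      proof (cases "i \<le> j")
        case True
        then show ?thesis unfolding UM_nat_entries(1)
          by (subst finsum_unique_nonzero[of _ i])
            (use M in \<open>auto simp: UM_nat_entries UM_nat_entry_closed\<close>)
      qed (simp add: UM_nat_entries UM_nat_entry_zero[OF M])
    qed
    show "M \<otimes>\<^bsub>UM_nat R\<^esub> \<one>\<^bsub>UM_nat R\<^esub> = M"
    proof (intro ext)
      fix i j
      show "(M \<otimes>\<^bsub>UM_nat R\<^esub> \<one>\<^bsub>UM_nat R\<^esub>) i j = M i j"
      proof (cases "i \<le> j")
        case True
        then show ?thesis unfolding UM_nat_entries(1)
          by (subst finsum_unique_nonzero[of _ j])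
            (use M in \<open>auto simp: UM_nat_entries UM_nat_entry_closed\<close>)
      qed (simp add: UM_nat_entries UM_nat_entry_zero[OF M])
    qed
  qed (auto intro: UM_nat_closed)
next
  fix L M N
  assume LMN: "L \<in> carrier (UM_nat R)" "M \<in> carrier (UM_nat R)" "N \<in> carrier (UM_nat R)"
  note closed = LMN[THEN UM_nat_entry_closed]
  show "(L \<oplus>\<^bsub>UM_nat R\<^esub> M) \<otimes>\<^bsub>UM_nat R\<^esub> N = L \<otimes>\<^bsub>UM_nat R\<^esub> N \<oplus>\<^bsub>UM_nat R\<^esub> M \<otimes>\<^bsub>UM_nat R\<^esub> N"
  proof (intro ext)
    fix i j
    have "((L \<oplus>\<^bsub>UM_nat R\<^esub> M) \<otimes>\<^bsub>UM_nat R\<^esub> N) i j = (\<Oplus>k\<in>{i..j}. L i k \<otimes> N k j \<oplus> M i k \<otimes> N k j)"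
      unfolding UM_nat_entries(1)
      by (intro add.finprod_cong') (auto simp: UM_nat_entries closed l_distr)
    then show "((L \<oplus>\<^bsub>UM_nat R\<^esub> M) \<otimes>\<^bsub>UM_nat R\<^esub> N) i j = (L \<otimes>\<^bsub>UM_nat R\<^esub> N \<oplus>\<^bsub>UM_nat R\<^esub> M \<otimes>\<^bsub>UM_nat R\<^esub> N) i j"
      by (simp add: UM_nat_entries closed Pi_def)
  qed
  show "N \<otimes>\<^bsub>UM_nat R\<^esub> (L \<oplus>\<^bsub>UM_nat R\<^esub> M) = N \<otimes>\<^bsub>UM_nat R\<^esub> L \<oplus>\<^bsub>UM_nat R\<^esub> N \<otimes>\<^bsub>UM_nat R\<^esub> M"
  proof (intro ext)
    fix i j
    have "(N \<otimes>\<^bsub>UM_nat R\<^esub> (L \<oplus>\<^bsub>UM_nat R\<^esub> M)) i j = (\<Oplus>k\<in>{i..j}. N i k \<otimes> L k j \<oplus> N i k \<otimes> M k j)"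
      unfolding UM_nat_entries(1)
      by (intro add.finprod_cong') (auto simp: UM_nat_entries closed r_distr)
    then show "(N \<otimes>\<^bsub>UM_nat R\<^esub> (L \<oplus>\<^bsub>UM_nat R\<^esub> M)) i j = (N \<otimes>\<^bsub>UM_nat R\<^esub> L \<oplus>\<^bsub>UM_nat R\<^esub> N \<otimes>\<^bsub>UM_nat R\<^esub> M) i j"
      by (simp add: UM_nat_entries closed Pi_def)
  qed
qed

lemma UM_nat_finsum_entry:
  assumes "finite A" "\<And>k. k \<in> A \<Longrightarrow> f k \<in> carrier (UM_nat R)"
  shows "(\<Oplus>\<^bsub>UM_nat R\<^esub>k\<in>A. f k) p q = (\<Oplus>k\<in>A. f k p q)"
  using assms
proof (induction A rule: finite_induct)
  case empty
  interpret UR: ring "UM_nat R" by (rule ring_UM_nat)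
  show ?case by (simp add: UM_nat_entries)
next
  case (insert x A)
  interpret UR: ring "UM_nat R" by (rule ring_UM_nat)
  have "(\<Oplus>\<^bsub>UM_nat R\<^esub>k\<in>insert x A. f k) = f x \<oplus>\<^bsub>UM_nat R\<^esub> (\<Oplus>\<^bsub>UM_nat R\<^esub>k\<in>A. f k)"
    using insert by (intro UR.finsum_insert) auto
  moreover have "(\<Oplus>k\<in>insert x A. f k p q) = f x p q \<oplus> (\<Oplus>k\<in>A. f k p q)"
    using insert by (intro finsum_insert) (auto intro: UM_nat_entry_closed)
  ultimately show ?case
    using insert by (simp add: UM_nat_entries)
qed

end

section \<open>Direct and stable finiteness\<close>

text \<open>Push a one-sided inverse forward to \<open>S\<close>, reverse the product there, and
  pull the resulting equation back by injectivity. Direct finiteness speaks only of multiplication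
  and one, so \<open>h\<close> is taken as a map of multiplicative monoids.\<close>

lemma directly_finite_inj_on:
  assumes "directly_finite S" "monoid R" "h \<in> carrier R \<rightarrow> carrier S" "inj_on h (carrier R)"
    and "h \<one>\<^bsub>R\<^esub> = \<one>\<^bsub>S\<^esub>"
    and "\<And>x y. \<lbrakk>x \<in> carrier R; y \<in> carrier R\<rbrakk> \<Longrightarrow> h (x \<otimes>\<^bsub>R\<^esub> y) = h x \<otimes>\<^bsub>S\<^esub> h y"
  shows "directly_finite R"
  unfolding directly_finite_def
proof (intro ballI impI)
  interpret monoid R by fact
  fix r s assume rs: "r \<in> carrier R" "s \<in> carrier R" "r \<otimes>\<^bsub>R\<^esub> s = \<one>\<^bsub>R\<^esub>"
  then have "h r \<otimes>\<^bsub>S\<^esub> h s = \<one>\<^bsub>S\<^esub>"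
    using assms(5,6) by metis
  then have "h s \<otimes>\<^bsub>S\<^esub> h r = \<one>\<^bsub>S\<^esub>"
    using assms(1,3) rs unfolding directly_finite_def by blast
  then have "h (s \<otimes>\<^bsub>R\<^esub> r) = h \<one>\<^bsub>R\<^esub>"
    using assms(5,6) rs by simp
  then show "s \<otimes>\<^bsub>R\<^esub> r = \<one>\<^bsub>R\<^esub>"
    using assms(4) rs by (auto dest: inj_onD)
qed

text \<open>Both directions come from \<open>directly_finite_inj_on\<close>, one with
  \<open>h\<close> and one with its inverse. The inverse is multiplicative because every element of
  \<open>S\<close> is an image under \<open>h\<close>.\<close>

lemma directly_finite_bij_betw:
  assumes "monoid R" "monoid S" "bij_betw h (carrier R) (carrier S)"
    and one: "h \<one>\<^bsub>R\<^esub> = \<one>\<^bsub>S\<^esub>"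
    and mult: "\<And>x y. \<lbrakk>x \<in> carrier R; y \<in> carrier R\<rbrakk> \<Longrightarrow> h (x \<otimes>\<^bsub>R\<^esub> y) = h x \<otimes>\<^bsub>S\<^esub> h y"
  shows "directly_finite R \<longleftrightarrow> directly_finite S"
proof
  interpret R: monoid R by fact
  interpret S: monoid S by fact
  let ?g = "inv_into (carrier R) h"
  have inj: "inj_on h (carrier R)" and img: "h ` carrier R = carrier S"
    using assms(3) by (auto simp: bij_betw_def)
  show "directly_finite R" if "directly_finite S"
    by (rule directly_finite_inj_on[where h = h, OF that assms(1) _ inj one mult]) (use img in auto)
  show "directly_finite S" if "directly_finite R"
  proof (rule directly_finite_inj_on[where h = ?g])
    show "?g \<in> carrier S \<rightarrow> carrier R"
      using img by (auto intro: inv_into_into)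
    show "inj_on ?g (carrier S)"
      using img by (simp add: inj_on_inv_into)
    show "?g \<one>\<^bsub>S\<^esub> = \<one>\<^bsub>R\<^esub>"
      using inj one by (metis R.one_closed inv_into_f_f)
    fix x y assume "x \<in> carrier S" "y \<in> carrier S"
    then obtain a b where "a \<in> carrier R" "b \<in> carrier R" "x = h a" "y = h b"
      using img by blast
    then show "?g (x \<otimes>\<^bsub>S\<^esub> y) = ?g x \<otimes>\<^bsub>R\<^esub> ?g y"
      using inj mult by (metis R.m_closed inv_into_f_f)
  qed (use that in \<open>auto intro: S.monoid_axioms\<close>)
qed

section \<open>Direct finiteness of upper triangular matrices\<close>

context ring
begin

text \<open>Strong induction on the distance \<open>j - i\<close> from the diagonal. In the
  \<open>(i, j)\<close> entry of \<open>E E\<close> the two end terms each give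
  \<open>E i j\<close>, and all others contain an entry closer to the diagonal; hence
  \<open>E i j\<close> equals its own double and is zero.\<close>

lemma UM_nat_idem_eq_one:
  assumes E: "E \<in> carrier (UM_nat R)" and idem: "E \<otimes>\<^bsub>UM_nat R\<^esub> E = E"
    and diag: "\<And>i. E i i = \<one>"
  shows "E = \<one>\<^bsub>UM_nat R\<^esub>"
proof -
  note closed = UM_nat_entry_closed[OF E]
  have upper: "E i j = \<zero>" if "i < j" for i j
    using that
  proof (induction "j - i" arbitrary: i j rule: less_induct)
    case less
    \<comment> \<open>The first factor already vanishes by induction, since
      \<open>k - i < j - i\<close>.\<close>
    have mid: "E i k \<otimes> E k j = \<zero>" if "i < k" "k < j" for k
      using less.hyps[of k i] that by (simp add: closed diff_less_mono)
    have "E i j = (\<Oplus>k\<in>{i..j}. E i k \<otimes> E k j)"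
      by (subst idem[symmetric]) (simp only: UM_nat_entries)
    also have "\<dots> = (\<Oplus>k\<in>{i, j}. E i k \<otimes> E k j)"
      by (rule add.finprod_mono_neutral_cong_right)
        (use less.prems in \<open>auto simp: closed intro!: mid\<close>)
    also have "\<dots> = E i j \<oplus> E i j"
      using less.prems by (simp add: closed diag)
    finally show ?case
      using closed by (metis add.l_cancel_one')
  qed
  show ?thesis
  proof (intro ext)
    fix i j :: nat
    show "E i j = \<one>\<^bsub>UM_nat R\<^esub> i j"
      by (cases i j rule: linorder_cases)
        (auto simp: UM_nat_entries upper diag UM_nat_entry_zero[OF E])
  qed
qed

lemma directly_finite_UM_nat_iff: "directly_finite (UM_nat R) \<longleftrightarrow> directly_finite R"
proof
  assume fin: "directly_finite R"
  interpret UR: ring "UM_nat R" by (rule ring_UM_nat)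
  show "directly_finite (UM_nat R)"
    unfolding directly_finite_def
  proof (intro ballI impI)
    fix M N
    assume MN: "M \<in> carrier (UM_nat R)" "N \<in> carrier (UM_nat R)"
      and one: "M \<otimes>\<^bsub>UM_nat R\<^esub> N = \<one>\<^bsub>UM_nat R\<^esub>"
    note closed = MN[THEN UM_nat_entry_closed]
    show "N \<otimes>\<^bsub>UM_nat R\<^esub> M = \<one>\<^bsub>UM_nat R\<^esub>"
    proof (rule UM_nat_idem_eq_one)
      show "N \<otimes>\<^bsub>UM_nat R\<^esub> M \<in> carrier (UM_nat R)"
        using MN by simp
      have "N \<otimes>\<^bsub>UM_nat R\<^esub> M \<otimes>\<^bsub>UM_nat R\<^esub> (N \<otimes>\<^bsub>UM_nat R\<^esub> M) =
          N \<otimes>\<^bsub>UM_nat R\<^esub> (M \<otimes>\<^bsub>UM_nat R\<^esub> N) \<otimes>\<^bsub>UM_nat R\<^esub> M"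
        using MN by (simp add: UR.m_assoc)
      then show "N \<otimes>\<^bsub>UM_nat R\<^esub> M \<otimes>\<^bsub>UM_nat R\<^esub> (N \<otimes>\<^bsub>UM_nat R\<^esub> M) = N \<otimes>\<^bsub>UM_nat R\<^esub> M"
        using MN by (simp add: one)
      fix i
      \<comment> \<open>On the diagonal the range \<open>{i..i}\<close> is a single point, so the
        diagonal entry of a product is the product of the diagonal entries.\<close>
      have "M i i \<otimes> N i i = \<one>"
        using fun_cong[OF fun_cong[OF one, of i], of i] by (simp add: UM_nat_entries closed)
      then have "N i i \<otimes> M i i = \<one>"
        using fin closed unfolding directly_finite_def by blast
      then show "(N \<otimes>\<^bsub>UM_nat R\<^esub> M) i i = \<one>"
        by (simp add: UM_nat_entries)
    qed
  qed
next
  assume fin: "directly_finite (UM_nat R)"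
  \<comment> \<open>The scalar matrix with \<open>r\<close> along the diagonal; any diagonal entry
    recovers \<open>r\<close>, which gives injectivity.\<close>
  let ?h = "\<lambda>r i j :: nat. if i = j then r else \<zero>"
  show "directly_finite R"
  proof (rule directly_finite_inj_on[OF fin, where h = ?h])
    show "?h \<in> carrier R \<rightarrow> carrier (UM_nat R)"
      by (auto simp: UM_nat_def)
    show "inj_on ?h (carrier R)"
      by (rule inj_onI) (metis (full_types))
    show "?h \<one> = \<one>\<^bsub>UM_nat R\<^esub>"
      by (simp add: UM_nat_def)
    fix x y assume xy: "x \<in> carrier R" "y \<in> carrier R"
    show "?h (x \<otimes> y) = ?h x \<otimes>\<^bsub>UM_nat R\<^esub> ?h y"
    proof (intro ext)
      fix i j :: nat
      show "?h (x \<otimes> y) i j = (?h x \<otimes>\<^bsub>UM_nat R\<^esub> ?h y) i j"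
      proof (cases "i = j")
        case True
        then show ?thesis using xy by (simp add: UM_nat_entries)
      next
        \<comment> \<open>No \<open>k\<close> equals both \<open>i\<close> and \<open>j\<close>, so
          every term has a zero factor.\<close>
        case False
        then show ?thesis using xy
          by (subst UM_nat_entries, subst finsum_eq_zero) auto
      qed
    qed
  qed (rule monoid_axioms)
qed

section \<open>Exchange of the two matrix constructions and stable finiteness\<close>

text \<open>A matrix of matrices has entries \<open>X i j p q\<close>, and exchanging the index
  pairs \<open>(i, j)\<close> and \<open>(p, q)\<close> is a bijection. It respects products because
  an entry of a product is, on either side, a double sum over the same finite ranges, taken in
  opposite orders.\<close>

lemma directly_finite_mat_ring_UM_nat_iff:
  "directly_finite (mat_ring n (UM_nat R)) \<longleftrightarrow> directly_finite (UM_nat (mat_ring n R))"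
proof -
  interpret UR: ring "UM_nat R" by (rule ring_UM_nat)
  interpret MR: ring "mat_ring n R" by (rule ring_mat_ring)
  interpret MU: ring "mat_ring n (UM_nat R)" by (rule UR.ring_mat_ring)
  interpret UM: ring "UM_nat (mat_ring n R)" by (rule MR.ring_UM_nat)
  \<comment> \<open>In both maps only the indices below \<open>n\<close> are restricted, as
    \<open>mat_ring\<close> demands extensional functions, while \<open>p\<close> and
    \<open>q\<close> range over all natural numbers.\<close>
  let ?h = "\<lambda>X p q. \<lambda>i\<in>{..<n}. \<lambda>j\<in>{..<n}. X i j p q"
  let ?g = "\<lambda>Y. \<lambda>i\<in>{..<n}. \<lambda>j\<in>{..<n}. \<lambda>p q. Y p q i j"
  have entry: "X i j p q \<in> carrier R"
    if "X \<in> carrier (mat_ring n (UM_nat R))" "i < n" "j < n" for X i j p q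
    by (rule UM_nat_entry_closed[OF mat_ring_entry_closed[OF that]])
  have h_closed: "?h X \<in> carrier (UM_nat (mat_ring n R))"
    if "X \<in> carrier (mat_ring n (UM_nat R))" for X
  proof -
    have "?h X p q \<in> carrier (mat_ring n R)" for p q
      using that by (auto intro!: mat_ring_closedI entry)
    \<comment> \<open>Below the diagonal every \<open>X i j p q\<close> with \<open>i, j < n\<close>
      is zero, and the restrictions make the block the extensional zero matrix.\<close>
    moreover have "?h X p q = \<zero>\<^bsub>mat_ring n R\<^esub>" if "q < p" for p q
      using \<open>X \<in> _\<close> that
      by (auto simp: mat_ring_def[of n R] restrict_def fun_eq_iff
          intro!: UM_nat_entry_zero[where R = R] mat_ring_entry_closed[where n = n])
    ultimately show ?thesis
      by (simp add: UM_nat_def[of "mat_ring n R"])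
  qed
  have g_closed: "?g Y \<in> carrier (mat_ring n (UM_nat R))"
    if Y: "Y \<in> carrier (UM_nat (mat_ring n R))" for Y
  proof (rule mat_ring_closedI)
    fix i j assume ij: "i < n" "j < n"
    have "Y p q i j \<in> carrier R" for p q
      by (rule mat_ring_entry_closed[OF UM_nat_entry_closed[OF Y] ij])
    moreover have "Y p q i j = \<zero>" if "q < p" for p q
      using UM_nat_entry_zero[OF Y that] ij by (simp add: mat_ring_entries)
    ultimately show "(\<lambda>p q. Y p q i j) \<in> carrier (UM_nat R)"
      by (simp add: UM_nat_def)
  qed
  show ?thesis
  proof (rule directly_finite_bij_betw[where h = ?h])
    show "bij_betw ?h (carrier (mat_ring n (UM_nat R))) (carrier (UM_nat (mat_ring n R)))"
    proof (rule bij_betw_byWitness[where f' = ?g])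
      show "\<forall>X\<in>carrier (mat_ring n (UM_nat R)). ?g (?h X) = X"
        by (intro ballI mat_ring_eqI[of _ n "UM_nat R"] g_closed h_closed) auto
      show "\<forall>Y\<in>carrier (UM_nat (mat_ring n R)). ?h (?g Y) = Y"
      proof
        fix Y assume Y: "Y \<in> carrier (UM_nat (mat_ring n R))"
        have "?h (?g Y) p q = Y p q" for p q
          by (rule mat_ring_eqI[OF UM_nat_entry_closed[OF h_closed[OF g_closed[OF Y]]]
                UM_nat_entry_closed[OF Y]]) auto
        then show "?h (?g Y) = Y" by blast
      qed
    qed (use h_closed g_closed in blast)+
    show "?h \<one>\<^bsub>mat_ring n (UM_nat R)\<^esub> = \<one>\<^bsub>UM_nat (mat_ring n R)\<^esub>"
      by (auto simp: mat_ring_def UM_nat_def fun_eq_iff restrict_def)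
    fix X Y
    assume X: "X \<in> carrier (mat_ring n (UM_nat R))" and Y: "Y \<in> carrier (mat_ring n (UM_nat R))"
    show "?h (X \<otimes>\<^bsub>mat_ring n (UM_nat R)\<^esub> Y) = ?h X \<otimes>\<^bsub>UM_nat (mat_ring n R)\<^esub> ?h Y"
    proof (rule ext, rule ext)
      fix p q
      show "?h (X \<otimes>\<^bsub>mat_ring n (UM_nat R)\<^esub> Y) p q = (?h X \<otimes>\<^bsub>UM_nat (mat_ring n R)\<^esub> ?h Y) p q"
      proof (rule mat_ring_eqI)
        show "?h (X \<otimes>\<^bsub>mat_ring n (UM_nat R)\<^esub> Y) p q \<in> carrier (mat_ring n R)"
          by (rule UM_nat_entry_closed[OF h_closed[OF MU.m_closed[OF X Y]]])
        show "(?h X \<otimes>\<^bsub>UM_nat (mat_ring n R)\<^esub> ?h Y) p q \<in> carrier (mat_ring n R)"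
          by (rule UM_nat_entry_closed[OF UM.m_closed[OF h_closed[OF X] h_closed[OF Y]]])
        fix i j assume ij: "i < n" "j < n"
        have "?h (X \<otimes>\<^bsub>mat_ring n (UM_nat R)\<^esub> Y) p q i j =
            (\<Oplus>\<^bsub>UM_nat R\<^esub>k\<in>{..<n}. X i k \<otimes>\<^bsub>UM_nat R\<^esub> Y k j) p q"
          using ij by (simp add: mat_ring_entries)
        \<comment> \<open>The \<open>(p, q)\<close> entry is taken inside the sum over
          \<open>k\<close>, and each triangular product expands into a sum over
          \<open>r\<close>.\<close>
        also have "\<dots> = (\<Oplus>k\<in>{..<n}. \<Oplus>r\<in>{p..q}. X i k p r \<otimes> Y k j r q)"
          using ij X Y
          by (subst UM_nat_finsum_entry) (auto simp: UM_nat_entries mat_ring_entry_closed)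
        also have "\<dots> = (\<Oplus>r\<in>{p..q}. \<Oplus>k\<in>{..<n}. X i k p r \<otimes> Y k j r q)"
          using ij X Y by (intro finsum_swap) (auto simp: entry)
        \<comment> \<open>For fixed \<open>r\<close> the sum over \<open>k\<close> is the
          \<open>(i, j)\<close> entry of a product of two blocks.\<close>
        also have "\<dots> = (\<Oplus>r\<in>{p..q}. (?h X p r \<otimes>\<^bsub>mat_ring n R\<^esub> ?h Y r q) i j)"
          using ij X Y
          by (intro add.finprod_cong')
            (auto simp: mat_ring_entries entry intro!: add.finprod_cong' finsum_closed)
        also have "\<dots> = (?h X \<otimes>\<^bsub>UM_nat (mat_ring n R)\<^esub> ?h Y) p q i j"
          unfolding UM_nat_entries
          using ij UM_nat_entry_closed[OF h_closed[OF X]] UM_nat_entry_closed[OF h_closed[OF Y]]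
          by (intro mat_ring_finsum_entry[symmetric]) auto
        finally show "?h (X \<otimes>\<^bsub>mat_ring n (UM_nat R)\<^esub> Y) p q i j =
          (?h X \<otimes>\<^bsub>UM_nat (mat_ring n R)\<^esub> ?h Y) p q i j" .
      qed
    qed
  qed (rule MU.monoid_axioms UM.monoid_axioms)+
qed

text \<open>For each \<open>n\<close>, exchange the two constructions and then apply the result on
  direct finiteness with \<open>mat_ring n R\<close> as the base ring.\<close>

lemma stably_finite_UM_nat_iff: "stably_finite (UM_nat R) \<longleftrightarrow> stably_finite R"
  by (simp add: stably_finite_def directly_finite_mat_ring_UM_nat_iff
      ring.directly_finite_UM_nat_iff[OF ring_mat_ring])

end

theorem corollary1p18:
  fixes R :: "('a, 'm) ring_scheme"
  assumes "ring R"
  shows "(directly_finite (UM_nat R) \<longleftrightarrow> directly_finite R) \<and>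
         (stably_finite (UM_nat R) \<longleftrightarrow> stably_finite R)"
  using ring.directly_finite_UM_nat_iff[OF assms] ring.stably_finite_UM_nat_iff[OF assms] by blast

end
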